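(* Let Assumption 2 (stated in the context) hold and let $\epsilon>0$. Let $\mathcal{C}_r\subseteq\mathcal{S}_r$ be a compact set and assume that for any $(x,u)\in\mathcal{C}_r$ there exists $q_{(x,u)}\in\mathbb{R}^m$ such that: (i) if $b(u)=0$, then $\nabla b(u)^\top q_{(x,u)}>0$; (ii) if $h_r(x,u)=0$, then $\frac{\partial h_r}{\partial u}(x,u)\,q_{(x,u)}+\frac{\partial h_r}{\partial x}(x,u)f(x,u)>0$. Then there exist $\alpha_f,\gamma_f>0$ such that, for all $\alpha>\alpha_f$ and $\gamma>\gamma_f$, the quadratic program (SGF) is feasible for every $(x,u)\in\mathcal{C}_r$.
   Context: Conventions: for differentiable $g:\mathbb{R}^n\to\mathbb{R}^k$, $\frac{\partial g}{\partial x}\in\mathbb{R}^{k\times n}$ (so partial derivatives of scalar functions are row vectors); for scalar $g$, $\nabla g=(\frac{\partial g}{\partial x})^\top$. Plant: $\dot\xi=f(\xi,\upsilon)$ with $f:\mathbb{R}^n\times\mathbb{R}^m\to\mathbb{R}^n$. Assumption 1 (used to define $w$): for every constant input $\upsilon\equiv u$ the system has a unique globally exponentially stable equilibrium; it is denoted $w(u)$, giving a map $w:\mathbb{R}^m\to\mathbb{R}^n$ with $f(w(u),u)=0$. Data: $\Phi,h:\mathbb{R}^n\to\mathbb{R}$, $b:\mathbb{R}^m\to\mathbb{R}$. Fix $\beta>0$ and set $h_0(x,u)=h(x)$, $h_i(x,u)=\frac{\partial h_{i-1}}{\partial x}(x,u)f(x,u)+\beta h_{i-1}(x,u)$ for $i\ge1$.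 Let $\mathcal{S}=\{(x,u): h(x)\ge0,\ b(u)\ge0\}$ and $\mathcal{S}_i=\{(x,u): b(u)\ge0,\ h_i(x,u)\ge0\}$ for $i\ge0$, so $\mathcal{S}_0=\mathcal{S}$. Assumption 2: (1) there is an integer $r\ge1$ such that $f$ is $(r+1)$-times and $h$ is $(r+2)$-times continuously differentiable; $\mathcal{S}_r\ne\emptyset$; $\frac{\partial h_r}{\partial u}(x,u)\ne0$ for all $(x,u)\in\mathcal{S}_r$ with $h_r(x,u)=0$; and $\frac{\partial h_i}{\partial u}(x,u)=0$ for all $(x,u)\in\mathcal{S}_r$ and all $i<r$. (2) $b$ is twice continuously differentiable, and $b(u)=0$ implies $\nabla b(u)\neq0$ for all $(x,u)\in\mathcal{S}$. (3) $\Phi$ and $w$ are twice continuously differentiable. This fixes $r$. Quadratic program (SGF), with parameters $\epsilon,\alpha,\gamma>0$: for given $(x,u)$, minimize over $q\in\mathbb{R}^m$ the function $\frac12\|q+\epsilon\frac{\partial w}{\partial u}(u)^\top\nabla\Phi(x)\|^2$ subject to $\nabla b(u)^\top q+\alpha b(u)\ge0$ and $\frac{\partial h_r}{\partial x}(x,u)f(x,u)+\frac{\partial h_r}{\partial u}(x,u)q+\gamma h_r(x,u)\ge0$. Feasible means that the constraint set is nonempty. *)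

theory Defs
  imports "HOL-Analysis.Analysis"
begin

text \<open>
  \<open>C_k k g\<close>: \<open>g\<close> is \<open>k\<close> times continuously differentiable on the whole space. In
  finite dimension this is continuity of all iterated directional derivatives up to order \<open>k\<close>.
\<close>
primrec C_k :: "nat \<Rightarrow> ('a::euclidean_space \<Rightarrow> 'b::euclidean_space) \<Rightarrow> bool" where
  "C_k 0 g \<longleftrightarrow> continuous_on UNIV g"
| "C_k (Suc k) g \<longleftrightarrow>
     (\<forall>x. g differentiable (at x)) \<and> (\<forall>v. C_k k (\<lambda>x. frechet_derivative g (at x) v))"

text \<open>
  The row vector of partial derivatives of a scalar function is identified with its transpose,
  the gradient; a row vector applied to a column vector becomes the inner product \<open>\<bullet>\<close>.
\<close>
definition grad :: "(real^'k \<Rightarrow> real) \<Rightarrow> real^'k \<Rightarrow> real^'k" where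
  "grad g x = (\<chi> i. frechet_derivative g (at x) (axis i 1))"

definition grad_x :: "((real^'n) \<times> (real^'m) \<Rightarrow> real) \<Rightarrow> (real^'n) \<times> (real^'m) \<Rightarrow> real^'n" where
  "grad_x g = (\<lambda>(x, u). grad (\<lambda>y. g (y, u)) x)"

definition grad_u :: "((real^'n) \<times> (real^'m) \<Rightarrow> real) \<Rightarrow> (real^'n) \<times> (real^'m) \<Rightarrow> real^'m" where
  "grad_u g = (\<lambda>(x, u). grad (\<lambda>v. g (x, v)) u)"

definition solution_of ::
  "((real^'n) \<times> (real^'m) \<Rightarrow> real^'n) \<Rightarrow> real^'m \<Rightarrow> (real \<Rightarrow> real^'n) \<Rightarrow> bool" where
  "solution_of f u \<xi> \<longleftrightarrow>
     (\<forall>t\<ge>0. (\<xi> has_vector_derivative f (\<xi> t, u)) (at t within {0..}))"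

text \<open>
  Global existence of trajectories is part of the notion, so that the decay estimate covers
  every initial state.
\<close>
definition glob_exp_stable_equilibrium ::
  "((real^'n) \<times> (real^'m) \<Rightarrow> real^'n) \<Rightarrow> real^'m \<Rightarrow> real^'n \<Rightarrow> bool" where
  "glob_exp_stable_equilibrium f u xe \<longleftrightarrow>
     f (xe, u) = 0 \<and>
     (\<forall>x0. \<exists>\<xi>. solution_of f u \<xi> \<and> \<xi> 0 = x0) \<and>
     (\<exists>M>0. \<exists>\<kappa>>0. \<forall>\<xi>. solution_of f u \<xi> \<longrightarrow>
        (\<forall>t\<ge>0. norm (\<xi> t - xe) \<le> M * exp (- \<kappa> * t) * norm (\<xi> 0 - xe)))"

definition assumption1 :: "((real^'n) \<times> (real^'m) \<Rightarrow> real^'n) \<Rightarrow> bool" where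
  "assumption1 f \<longleftrightarrow> (\<forall>u. \<exists>!xe. glob_exp_stable_equilibrium f u xe)"

definition steady_state :: "((real^'n) \<times> (real^'m) \<Rightarrow> real^'n) \<Rightarrow> real^'m \<Rightarrow> real^'n" where
  "steady_state f u = (THE xe. glob_exp_stable_equilibrium f u xe)"

primrec h_seq ::
  "((real^'n) \<times> (real^'m) \<Rightarrow> real^'n) \<Rightarrow> (real^'n \<Rightarrow> real) \<Rightarrow> real \<Rightarrow> nat \<Rightarrow>
    (real^'n) \<times> (real^'m) \<Rightarrow> real" where
  "h_seq f h \<beta> 0 = (\<lambda>(x, u). h x)"
| "h_seq f h \<beta> (Suc i) =
     (\<lambda>z. grad_x (h_seq f h \<beta> i) z \<bullet> f z + \<beta> * h_seq f h \<beta> i z)"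

definition S_seq ::
  "((real^'n) \<times> (real^'m) \<Rightarrow> real^'n) \<Rightarrow> (real^'n \<Rightarrow> real) \<Rightarrow> (real^'m \<Rightarrow> real) \<Rightarrow> real \<Rightarrow> nat \<Rightarrow>
    ((real^'n) \<times> (real^'m)) set" where
  "S_seq f h b \<beta> i = {(x, u). b u \<ge> 0 \<and> h_seq f h \<beta> i (x, u) \<ge> 0}"

definition assumption2 ::
  "((real^'n) \<times> (real^'m) \<Rightarrow> real^'n) \<Rightarrow> (real^'n \<Rightarrow> real) \<Rightarrow> (real^'m \<Rightarrow> real) \<Rightarrow>
    (real^'n \<Rightarrow> real) \<Rightarrow> real \<Rightarrow> nat \<Rightarrow> bool" where
  "assumption2 f h b \<Phi> \<beta> r \<longleftrightarrow>
     r \<ge> 1 \<and> C_k (r + 1) f \<and> C_k (r + 2) h \<and>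
     S_seq f h b \<beta> r \<noteq> {} \<and>
     (\<forall>z \<in> S_seq f h b \<beta> r. h_seq f h \<beta> r z = 0 \<longrightarrow> grad_u (h_seq f h \<beta> r) z \<noteq> 0) \<and>
     (\<forall>z \<in> S_seq f h b \<beta> r. \<forall>i<r. grad_u (h_seq f h \<beta> i) z = 0) \<and>
     C_k 2 b \<and>
     (\<forall>(x, u) \<in> S_seq f h b \<beta> 0. b u = 0 \<longrightarrow> grad b u \<noteq> 0) \<and>
     C_k 2 \<Phi> \<and> C_k 2 (steady_state f)"

text \<open>An optimization problem is an objective to be minimized together with a constraint set.\<close>
type_synonym 'a program = "('a \<Rightarrow> real) \<times> 'a set"

definition feasible :: "'a program \<Rightarrow> bool" where
  "feasible P \<longleftrightarrow> snd P \<noteq> {}"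

definition SGF ::
  "((real^'n) \<times> (real^'m) \<Rightarrow> real^'n) \<Rightarrow> (real^'n \<Rightarrow> real) \<Rightarrow> (real^'m \<Rightarrow> real) \<Rightarrow>
    (real^'n \<Rightarrow> real) \<Rightarrow> real \<Rightarrow> nat \<Rightarrow> real \<Rightarrow> real \<Rightarrow> real \<Rightarrow>
    real^'n \<Rightarrow> real^'m \<Rightarrow> (real^'m) program" where
  "SGF f h b \<Phi> \<beta> r \<epsilon> \<alpha> \<gamma> x u =
     (\<lambda>q. 1 / 2 * (norm (q + \<epsilon> *\<^sub>R
              (transpose (jacobian (steady_state f) (at u)) *v grad \<Phi> x)))\<^sup>2,
      {q. grad b u \<bullet> q + \<alpha> * b u \<ge> 0 \<and>
          grad_x (h_seq f h \<beta> r) (x, u) \<bullet> f (x, u) + grad_u (h_seq f h \<beta> r) (x, u) \<bullet> q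
            + \<gamma> * h_seq f h \<beta> r (x, u) \<ge> 0})"

end

theory Submission
  imports Defs
begin

text \<open>
  Fix a point \<open>z\<close> of the compact set and a vector \<open>q\<close> as in the hypothesis. Each constraint has the
  form \<open>G z q + \<alpha> * c z \<ge> 0\<close> with \<open>c \<ge> 0\<close> on the set. If \<open>c z = 0\<close>, the hypothesis gives \<open>G z q > 0\<close>;
  if \<open>c z > 0\<close>, a large \<open>\<alpha>\<close> makes the sum positive. In both cases the inequality is strict for
  some \<open>\<alpha>\<close>, so by continuity the same \<open>q\<close> and \<open>\<alpha>\<close> serve in a neighbourhood of \<open>z\<close>, and because
  \<open>c \<ge> 0\<close> every larger \<open>\<alpha>\<close> serves at the points of the set there too. Finitely many neighbourhoods cover the set, and any
  common bound of their thresholds works everywhere (\<open>compact_uniform_threshold\<close>).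

  The remaining work is the continuity of the constraint data. Each step of the recursion
  for \<open>h\<^sub>i\<close> costs one derivative, so \<open>h\<^sub>i\<close> is of class \<open>r + 2 - i\<close> (\<open>C_k_h_seq\<close>); hence \<open>h\<^sub>r\<close> is of
  class \<open>2\<close> and its partial gradients are continuous.
\<close>

section \<open>Uniform thresholds on compact sets\<close>

text \<open>
  The strict inequalities define an open set \<open>V n\<close> for each threshold \<open>n\<close>, and on \<open>C\<close> these sets
  grow with \<open>n\<close>; a finite subcover therefore reduces to a single one of them. No choice of \<open>q\<close>
  as a function of \<open>z\<close>, continuous or otherwise, is made.
\<close>
lemma compact_uniform_threshold:
  fixes G1 G2 :: "'a::topological_space \<Rightarrow> 'q \<Rightarrow> real" and c1 c2 :: "'a \<Rightarrow> real"
  assumes "compact C"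
    and cont: "continuous_on UNIV c1" "continuous_on UNIV c2"
      "\<And>q. continuous_on UNIV (\<lambda>z. G1 z q)" "\<And>q. continuous_on UNIV (\<lambda>z. G2 z q)"
    and nonneg: "\<And>z. z \<in> C \<Longrightarrow> c1 z \<ge> 0" "\<And>z. z \<in> C \<Longrightarrow> c2 z \<ge> 0"
    and ex: "\<And>z. z \<in> C \<Longrightarrow> \<exists>q. (c1 z = 0 \<longrightarrow> G1 z q > 0) \<and> (c2 z = 0 \<longrightarrow> G2 z q > 0)"
  shows "\<exists>t>0. \<forall>\<alpha>>t. \<forall>\<gamma>>t. \<forall>z\<in>C. \<exists>q. G1 z q + \<alpha> * c1 z \<ge> 0 \<and> G2 z q + \<gamma> * c2 z \<ge> 0"
proof -
  define V where
    "V n = (\<Union>q. {z. 0 < G1 z q + real n * c1 z} \<inter> {z. 0 < G2 z q + real n * c2 z})" for n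
  have open_V: "open (V n)" for n
    unfolding V_def by (intro open_UN ballI open_Int open_Collect_less continuous_intros cont)
  have large: "\<exists>n. \<forall>m\<ge>n. 0 < g + real m * c" if "c \<ge> 0" "c = 0 \<longrightarrow> g > 0" for g c :: real
  proof (cases "c = 0")
    case False
    with that have "c > 0" by simp
    then obtain n where n: "- g < real n * c"
      using reals_Archimedean3 by blast
    have "0 < g + real m * c" if "n \<le> m" for m
    proof -
      have "real n * c \<le> real m * c" using that \<open>c \<ge> 0\<close> by (simp add: mult_right_mono)
      with n show ?thesis by linarith
    qed
    then show ?thesis by blast
  next
    case True
    with that have "\<forall>m\<ge>0. 0 < g + real m * c" by simp
    then show ?thesis by blast
  qed
  have cover: "C \<subseteq> (\<Union>n\<in>UNIV. V n)"
  proof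
    fix z assume z: "z \<in> C"
    obtain q where q: "c1 z = 0 \<longrightarrow> G1 z q > 0" "c2 z = 0 \<longrightarrow> G2 z q > 0"
      using ex[OF z] by blast
    obtain n1 n2 where "\<forall>m\<ge>n1. 0 < G1 z q + real m * c1 z" "\<forall>m\<ge>n2. 0 < G2 z q + real m * c2 z"
      using large[OF nonneg(1)[OF z] q(1)] large[OF nonneg(2)[OF z] q(2)] by blast
    then have "0 < G1 z q + real (max n1 n2) * c1 z" "0 < G2 z q + real (max n1 n2) * c2 z"
      using max.cobounded1[of n1 n2] max.cobounded2[of n2 n1] by simp_all
    then have "z \<in> V (max n1 n2)" unfolding V_def by blast
    then show "z \<in> (\<Union>n\<in>UNIV. V n)" by blast
  qed
  obtain N where N: "finite N" "C \<subseteq> (\<Union>n\<in>N. V n)"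
    by (rule compactE_image[OF \<open>compact C\<close> open_V cover])
  \<comment> \<open>The sum dominates every member of \<open>N\<close>. The summand \<open>1\<close> keeps the threshold positive when \<open>C\<close>, and hence \<open>N\<close>, is empty.\<close>
  define t where "t = 1 + real (\<Sum>N)"
  have "\<exists>q. G1 z q + \<alpha> * c1 z \<ge> 0 \<and> G2 z q + \<gamma> * c2 z \<ge> 0"
    if "\<alpha> > t" "\<gamma> > t" and z: "z \<in> C" for \<alpha> \<gamma> z
  proof -
    from z N obtain n where n: "n \<in> N" "z \<in> V n" by blast
    then obtain q where q: "0 < G1 z q + real n * c1 z" "0 < G2 z q + real n * c2 z"
      by (auto simp: V_def)
    have "n \<le> \<Sum>N" using N(1) n(1) by (intro member_le_sum) auto
    then have "real n \<le> real (\<Sum>N)" by (rule of_nat_mono)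
    then have "real n \<le> \<alpha>" "real n \<le> \<gamma>" using that unfolding t_def by linarith+
    then have "real n * c1 z \<le> \<alpha> * c1 z" "real n * c2 z \<le> \<gamma> * c2 z"
      using nonneg z by (simp_all add: mult_right_mono)
    with q show ?thesis by (intro exI[of _ q] conjI) linarith+
  qed
  moreover have "t > 0" unfolding t_def by linarith
  ultimately show ?thesis by blast
qed

section \<open>Calculus of \<open>k\<close> times continuously differentiable maps\<close>

lemma C_k_SucD: "C_k (Suc k) g \<Longrightarrow> C_k k g"
proof (induction k arbitrary: g)
  case 0
  then show ?case
    by (auto intro!: continuous_at_imp_continuous_on differentiable_imp_continuous_within)
next
  case (Suc k)
  then show ?case unfolding C_k.simps(2)[of "Suc k"] C_k.simps(2)[of k] by blast
qed

lemma C_k_mono: "j \<le> k \<Longrightarrow> C_k k g \<Longrightarrow> C_k j g"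
  by (induction rule: inc_induct) (use C_k_SucD in blast)+

lemma C_k_continuous: "C_k k g \<Longrightarrow> continuous_on UNIV g"
  using C_k_mono[of 0 k g] by simp

lemma C_k_const: "C_k k (\<lambda>x. c)"
  by (induction k arbitrary: c) simp_all

lemma C_k_add:
  assumes "C_k k f" "C_k k g"
  shows "C_k k (\<lambda>x. f x + g x)"
  using assms
proof (induction k arbitrary: f g)
  case 0
  then show ?case by (auto intro: continuous_on_add)
next
  case (Suc k)
  have *: "((\<lambda>x. f x + g x) has_derivative
      (\<lambda>v. frechet_derivative f (at x) v + frechet_derivative g (at x) v)) (at x)" for x
    using Suc.prems by (intro has_derivative_add) (simp_all add: frechet_derivative_works[symmetric])
  then have "(\<lambda>x. f x + g x) differentiable (at x)" for x
    unfolding differentiable_def by blast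
  with Suc show ?case by (simp add: frechet_derivative_at[OF *, symmetric])
qed

lemma C_k_sum: "(\<And>i. i \<in> I \<Longrightarrow> C_k k (f i)) \<Longrightarrow> C_k k (\<lambda>x. \<Sum>i\<in>I. f i x)"
  by (induction I rule: infinite_finite_induct) (simp_all add: C_k_const C_k_add)

text \<open>By the product rule, differentiating a product again gives sums of such products.\<close>
lemma C_k_bilinear:
  fixes prod :: "'a::euclidean_space \<Rightarrow> 'b::euclidean_space \<Rightarrow> 'c::euclidean_space"
    and f :: "'x::euclidean_space \<Rightarrow> 'a"
  assumes "bounded_bilinear prod" "C_k k f" "C_k k g"
  shows "C_k k (\<lambda>x. prod (f x) (g x))"
  using assms(2,3)
proof (induction k arbitrary: f g)
  case 0
  then show ?case by (auto intro: bounded_bilinear.continuous_on[OF assms(1)])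
next
  case (Suc k)
  have *: "((\<lambda>x. prod (f x) (g x)) has_derivative
      (\<lambda>v. prod (f x) (frechet_derivative g (at x) v) +
        prod (frechet_derivative f (at x) v) (g x))) (at x)" for x
    using Suc.prems
    by (intro bounded_bilinear.FDERIV[OF assms(1)]) (simp_all add: frechet_derivative_works[symmetric])
  then have "(\<lambda>x. prod (f x) (g x)) differentiable (at x)" for x
    unfolding differentiable_def by blast
  moreover have "C_k k (\<lambda>x. prod (f x) (frechet_derivative g (at x) v) +
        prod (frechet_derivative f (at x) v) (g x))" for v
    using Suc by (intro C_k_add Suc.IH C_k_SucD[of k f] C_k_SucD[of k g]) simp_all
  ultimately show ?case
    by (simp add: frechet_derivative_at[OF *, symmetric])
qed

lemma C_k_fst:
  assumes "C_k k g"
  shows "C_k k (\<lambda>z. g (fst z))"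
  using assms
proof (induction k arbitrary: g)
  case 0
  then show ?case by (auto intro!: continuous_on_compose2[of UNIV g] continuous_intros)
next
  case (Suc k)
  have *: "((\<lambda>z. g (fst z)) has_derivative (\<lambda>v. frechet_derivative g (at (fst z)) (fst v))) (at z)"
    for z :: "'a \<times> 'c"
    using Suc.prems
    by (intro has_derivative_compose[where f = fst and g = g] has_derivative_fst has_derivative_ident)
      (simp add: frechet_derivative_works[symmetric])
  then have "(\<lambda>z. g (fst z)) differentiable (at z)" for z :: "'a \<times> 'c"
    unfolding differentiable_def by blast
  moreover have "C_k k (\<lambda>z::'a \<times> 'c. frechet_derivative g (at (fst z)) (fst v))" for v :: "'a \<times> 'c"
    using Suc.prems by (intro Suc.IH[of "\<lambda>x. frechet_derivative g (at x) (fst v)"]) simp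
  ultimately show ?case
    unfolding C_k.simps(2) frechet_derivative_at[OF *, symmetric] by blast
qed

section \<open>Regularity of gradients and of the functions \<open>h\<^sub>i\<close>\<close>

lemma vec_lambda_eq_sum: "(\<chi> i. c i) = (\<Sum>i\<in>UNIV. c i *\<^sub>R (axis i 1 :: real^'k))"
  by (simp add: vec_eq_iff axis_def if_distrib cong: if_cong)

lemma C_k_vec_lambda:
  fixes c :: "'k::finite \<Rightarrow> 'x::euclidean_space \<Rightarrow> real"
  assumes "\<And>i. C_k k (c i)"
  shows "C_k k (\<lambda>x. \<chi> i. c i x)"
  unfolding vec_lambda_eq_sum
  by (intro C_k_sum C_k_bilinear[OF bounded_bilinear_scaleR] C_k_const assms)

lemma C_k_grad: "C_k (Suc k) g \<Longrightarrow> C_k k (grad g)"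
  unfolding grad_def by (intro C_k_vec_lambda) simp

text \<open>
  Partial gradients are defined by restricting to a slice, whereas \<^const>\<open>C_k\<close> speaks of
  directional derivatives of the joint map; for a differentiable map the chain rule relates them.
\<close>
lemma grad_x_eq:
  assumes "g differentiable (at z)"
  shows "grad_x g z = (\<chi> i. frechet_derivative g (at z) (axis i 1, 0))"
proof -
  have "((\<lambda>y. g (y, snd z)) has_derivative (\<lambda>v. frechet_derivative g (at z) (v, 0))) (at (fst z))"
    by (rule has_derivative_compose[where f = "\<lambda>y. (y, snd z)" and g = g])
      (use assms in \<open>auto intro!: derivative_eq_intros simp: frechet_derivative_works[symmetric]\<close>)
  from frechet_derivative_at[OF this, symmetric] show ?thesis
    by (simp add: grad_x_def grad_def case_prod_beta)
qed

lemma grad_u_eq: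
  assumes "g differentiable (at z)"
  shows "grad_u g z = (\<chi> i. frechet_derivative g (at z) (0, axis i 1))"
proof -
  have "((\<lambda>v. g (fst z, v)) has_derivative (\<lambda>v. frechet_derivative g (at z) (0, v))) (at (snd z))"
    by (rule has_derivative_compose[where f = "\<lambda>v. (fst z, v)" and g = g])
      (use assms in \<open>auto intro!: derivative_eq_intros simp: frechet_derivative_works[symmetric]\<close>)
  from frechet_derivative_at[OF this, symmetric] show ?thesis
    by (simp add: grad_u_def grad_def case_prod_beta)
qed

lemma C_k_grad_x:
  assumes "C_k (Suc k) g"
  shows "C_k k (grad_x g)"
proof -
  have "grad_x g = (\<lambda>z. \<chi> i. frechet_derivative g (at z) (axis i 1, 0))"
    using assms unfolding C_k.simps by (intro ext grad_x_eq) blast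
  then show ?thesis using assms by (simp add: C_k_vec_lambda)
qed

lemma C_k_grad_u:
  assumes "C_k (Suc k) g"
  shows "C_k k (grad_u g)"
proof -
  have "grad_u g = (\<lambda>z. \<chi> i. frechet_derivative g (at z) (0, axis i 1))"
    using assms unfolding C_k.simps by (intro ext grad_u_eq) blast
  then show ?thesis using assms by (simp add: C_k_vec_lambda)
qed

text \<open>
  Every step of the recursion differentiates once. The first step multiplies a gradient of class
  \<open>r + 1\<close> by \<open>f\<close>, which is why one derivative less is needed of \<open>f\<close> than of \<open>h\<close>.
\<close>
lemma C_k_h_seq:
  assumes "C_k (r + 1) f" "C_k (r + 2) h" "i \<le> r + 2"
  shows "C_k (r + 2 - i) (h_seq f h \<beta> i)"
  using assms(3)
proof (induction i)
  case 0
  then show ?case using C_k_fst[OF assms(2)] by (simp add: case_prod_beta')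
next
  case (Suc i)
  let ?k = "r + 2 - Suc i"
  have k: "r + 2 - i = Suc ?k" using Suc.prems by simp
  have hi: "C_k (Suc ?k) (h_seq f h \<beta> i)" using Suc k by simp
  have "C_k ?k f" by (rule C_k_mono[OF _ assms(1)]) simp
  then show ?case
    unfolding h_seq.simps(2)
    by (intro C_k_add C_k_bilinear[OF bounded_bilinear_inner] C_k_grad_x[OF hi]
        C_k_bilinear[OF bounded_bilinear_mult] C_k_const C_k_SucD[OF hi])
qed

section \<open>Feasibility of the quadratic program\<close>

theorem mainTheorem1:
  fixes f :: "(real^'n) \<times> (real^'m) \<Rightarrow> real^'n"
    and h \<Phi> :: "real^'n \<Rightarrow> real"
    and b :: "real^'m \<Rightarrow> real"
    and \<beta> \<epsilon> :: real
    and r :: nat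
    and C :: "((real^'n) \<times> (real^'m)) set"
  assumes "\<beta> > 0"
    and "assumption1 f"
    and "assumption2 f h b \<Phi> \<beta> r"
    and "\<epsilon> > 0"
    and "compact C" and "C \<subseteq> S_seq f h b \<beta> r"
    and "\<forall>(x, u) \<in> C. \<exists>q :: real^'m.
           (b u = 0 \<longrightarrow> grad b u \<bullet> q > 0) \<and>
           (h_seq f h \<beta> r (x, u) = 0 \<longrightarrow>
              grad_u (h_seq f h \<beta> r) (x, u) \<bullet> q
                + grad_x (h_seq f h \<beta> r) (x, u) \<bullet> f (x, u) > 0)"
  shows "\<exists>\<alpha>\<^sub>f > 0. \<exists>\<gamma>\<^sub>f > 0. \<forall>\<alpha> > \<alpha>\<^sub>f. \<forall>\<gamma> > \<gamma>\<^sub>f. \<forall>(x, u) \<in> C.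
           feasible (SGF f h b \<Phi> \<beta> r \<epsilon> \<alpha> \<gamma> x u)"
proof -
  have f: "C_k (r + 1) f" and h: "C_k (r + 2) h" and b: "C_k 2 b"
    using assms(3) unfolding assumption2_def by blast+
  let ?h = "h_seq f h \<beta> r"
  have hr: "C_k (Suc 1) ?h" using C_k_h_seq[OF f h, of r] by (simp add: numeral_2_eq_2)
  have b2: "C_k (Suc 1) b" using b by (simp add: numeral_2_eq_2)
  have cb: "continuous_on UNIV (\<lambda>z::(real^'n) \<times> (real^'m). b (snd z))"
    and cgb: "continuous_on UNIV (\<lambda>z::(real^'n) \<times> (real^'m). grad b (snd z))"
    by (rule continuous_on_compose2[OF C_k_continuous[OF b2]]
        continuous_on_compose2[OF C_k_continuous[OF C_k_grad[OF b2]]];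
        auto intro: continuous_on_snd continuous_on_id)+
  note cont = cb cgb C_k_continuous[OF f] C_k_continuous[OF hr]
    C_k_continuous[OF C_k_grad_x[OF hr]] C_k_continuous[OF C_k_grad_u[OF hr]]
  have "\<exists>t>0. \<forall>\<alpha>>t. \<forall>\<gamma>>t. \<forall>z\<in>C. \<exists>q.
      grad b (snd z) \<bullet> q + \<alpha> * b (snd z) \<ge> 0 \<and>
      (grad_x ?h z \<bullet> f z + grad_u ?h z \<bullet> q) + \<gamma> * ?h z \<ge> 0"
  proof (rule compact_uniform_threshold[OF \<open>compact C\<close>])
    fix z assume z: "z \<in> C"
    then show "b (snd z) \<ge> 0" "?h z \<ge> 0"
      using assms(6) by (auto simp: S_seq_def)
    show "\<exists>q. (b (snd z) = 0 \<longrightarrow> grad b (snd z) \<bullet> q > 0) \<and>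
        (?h z = 0 \<longrightarrow> grad_x ?h z \<bullet> f z + grad_u ?h z \<bullet> q > 0)"
      using bspec[OF assms(7) z] by (simp add: case_prod_beta add.commute)
  qed (intro cont continuous_intros)+
  then obtain t where "t > 0" and t: "\<forall>\<alpha>>t. \<forall>\<gamma>>t. \<forall>z\<in>C. \<exists>q.
      grad b (snd z) \<bullet> q + \<alpha> * b (snd z) \<ge> 0 \<and>
      (grad_x ?h z \<bullet> f z + grad_u ?h z \<bullet> q) + \<gamma> * ?h z \<ge> 0"
    by blast
  have "feasible (SGF f h b \<Phi> \<beta> r \<epsilon> \<alpha> \<gamma> x u)" if asm: "\<alpha> > t" "\<gamma> > t" "(x, u) \<in> C" for \<alpha> \<gamma> x u
  proof -
    obtain q where "grad b u \<bullet> q + \<alpha> * b u \<ge> 0"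
      "grad_x ?h (x, u) \<bullet> f (x, u) + grad_u ?h (x, u) \<bullet> q + \<gamma> * ?h (x, u) \<ge> 0"
      using t[rule_format, OF asm] by auto
    then show ?thesis unfolding feasible_def SGF_def snd_conv by blast
  qed
  with \<open>t > 0\<close> show ?thesis by blast
qed

end
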